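(* Let $f:\mathbb{R}\to\mathbb{R}$ be a continuous function that is vertically rigid for some uncountable set $C\subset(0,\infty)$. Then there exist $a,b,k\in\mathbb{R}$ such that either $f(x)=a+bx$ for all $x\in\mathbb{R}$, or $f(x)=a+be^{kx}$ for all $x\in\mathbb{R}$.
   Context: For a function $h:\mathbb{R}\to\mathbb{R}$, $\mathrm{graph}(h)=\{(x,h(x)):x\in\mathbb{R}\}\subset\mathbb{R}^2$. For $C\subset(0,\infty)$, a function $f:\mathbb{R}\to\mathbb{R}$ is vertically rigid for $C$ if for every $c\in C$ there exists an isometry $\varphi$ of the Euclidean plane $\mathbb{R}^2$ with $\varphi(\mathrm{graph}(cf))=\mathrm{graph}(f)$. *)

theory Defs
  imports "HOL-Analysis.Analysis"
begin

definition graph_of :: "(real \<Rightarrow> real) \<Rightarrow> (real \<times> real) set" where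
  "graph_of h = {(x, h x) | x. x \<in> UNIV}"

(* The metric on real \<times> real is the Euclidean one (dist_Pair_Pair). Surjectivity is not required,
   since a distance-preserving self-map of the plane is automatically onto. *)
definition plane_isometry :: "(real \<times> real \<Rightarrow> real \<times> real) \<Rightarrow> bool" where
  "plane_isometry \<phi> \<longleftrightarrow> (\<forall>p q. dist (\<phi> p) (\<phi> q) = dist p q)"

definition vertically_rigid_for :: "(real \<Rightarrow> real) \<Rightarrow> real set \<Rightarrow> bool" where
  "vertically_rigid_for f C \<longleftrightarrow>
     (\<forall>c\<in>C. \<exists>\<phi>. plane_isometry \<phi> \<and> \<phi> ` graph_of (\<lambda>x. c * f x) = graph_of f)"

end

theory Submission
  imports Defs
begin

text \<open>The slopes of the chords of the graph form an interval \<open>I\<close>, and the chord directions form a double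
  cone \<open>K\<close> over \<open>I\<close>. If an isometry with linear part \<open>L\<^sub>c\<close> maps the graph of \<open>c f\<close> onto that of \<open>f\<close>, then the
  linear map \<open>(x, y) \<mapsto> L\<^sub>c (x, c y)\<close> permutes the at most two boundary lines of \<open>K\<close>.
  If \<open>I\<close> is bounded with endpoints \<open>s < t\<close>, then \<open>L\<^sub>c\<close> maps the lines of slopes \<open>c s\<close> and \<open>c t\<close> to those of
  slopes \<open>s\<close> and \<open>t\<close>; equality of the angles leaves at most three values of \<open>c\<close>. If \<open>I\<close> is unbounded, the
  vertical line is a boundary line, so \<open>L\<^sub>c\<close> sends the vertical unit vector to one of countably many
  vectors, and uncountably many \<open>c\<close> share the same \<open>L\<^sub>c\<close>. For these the graphs of \<open>c f\<close> are translates
  of each other, so \<open>f (x + t) = A f x + B\<close> for uncountably many \<open>t\<close>. Such \<open>t\<close> form a closed subgroup of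
  the reals, hence are all reals, and the functional equation is solved explicitly.\<close>

subsection \<open>Functions affinely equivalent to their translates\<close>

text \<open>Pigeonhole: without two points closer than \<open>e\<close>, every cell [n e, (n + 1) e)
  holds at most one point, so the cell index injects \<open>S\<close> into the integers.\<close>

lemma uncountable_imp_close_points:
  fixes S :: "real set"
  assumes "uncountable S" "e > 0"
  shows "\<exists>x\<in>S. \<exists>y\<in>S. 0 < x - y \<and> x - y < e"
proof (rule ccontr)
  assume far: "\<not> ?thesis"
  have "inj_on (\<lambda>x. \<lfloor>x / e\<rfloor>) S"
  proof (rule inj_onI)
    fix x y assume xy: "x \<in> S" "y \<in> S" "\<lfloor>x / e\<rfloor> = \<lfloor>y / e\<rfloor>"
    have "\<bar>x / e - y / e\<bar> < 1"
      using xy(3) floor_correct[of "x / e"] floor_correct[of "y / e"] by linarith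
    then have "\<bar>x - y\<bar> < e"
      using \<open>e > 0\<close> by (simp add: diff_divide_distrib[symmetric] abs_divide)
    then show "x = y"
      using far xy(1,2) by (metis abs_of_pos abs_minus_commute diff_gt_0_iff_gt linorder_neqE)
  qed
  then have "countable S"
    by (rule countableI')
  with assms(1) show False by simp
qed

text \<open>The integer multiples of a positive element below \<open>e\<close> form a grid of mesh
  less than \<open>e\<close>. Hence \<open>S\<close> is dense, and closedness does the rest.\<close>

lemma closed_subgroup_real_eq_UNIV:
  fixes S :: "real set"
  assumes "closed S" and diff: "\<And>x y. x \<in> S \<Longrightarrow> y \<in> S \<Longrightarrow> x - y \<in> S"
    and small: "\<And>e. e > 0 \<Longrightarrow> \<exists>t\<in>S. 0 < t \<and> t < e"
  shows "S = UNIV"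
proof -
  have zero: "0 \<in> S"
    using small[of 1] diff by fastforce
  have mult: "of_int n * t \<in> S" if "t \<in> S" for n t
  proof (induction n rule: int_induct[where k = 0])
    case base
    show ?case using zero by simp
  next
    case (step1 i)
    have "of_int i * t - (0 - t) \<in> S"
      using step1 that zero diff by blast
    then show ?case by (simp add: algebra_simps)
  next
    case (step2 i)
    have "of_int i * t - t \<in> S"
      using step2 that diff by blast
    then show ?case by (simp add: algebra_simps)
  qed
  have "x \<in> closure S" for x
    unfolding closure_approachable
  proof (intro allI impI)
    fix e :: real assume "e > 0"
    then obtain t where t: "t \<in> S" "0 < t" "t < e" using small by blast
    have "of_int \<lfloor>x / t\<rfloor> \<le> x / t" "x / t < of_int \<lfloor>x / t\<rfloor> + 1"
      by linarith+
    then have "of_int \<lfloor>x / t\<rfloor> * t \<le> x" "x < of_int \<lfloor>x / t\<rfloor> * t + t"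
      unfolding pos_le_divide_eq[OF t(2)] pos_divide_less_eq[OF t(2)] by (simp_all add: distrib_right)
    then have "dist (of_int \<lfloor>x / t\<rfloor> * t) x < e"
      using t(3) by (simp add: dist_real_def)
    then show "\<exists>y\<in>S. dist y x < e" using mult[OF t(1)] by blast
  qed
  then show ?thesis using \<open>closed S\<close> by auto
qed

text \<open>The points where \<open>g\<close> agrees with the linear map of slope \<open>g 1\<close>
  form a closed subgroup containing every 1/n, so they exhaust the line.\<close>

lemma continuous_additive_real:
  fixes g :: "real \<Rightarrow> real"
  assumes cont: "continuous_on UNIV g" and add: "\<And>s t. g (s + t) = g s + g t"
  shows "g t = g 1 * t"
proof -
  have zero: "g 0 = 0" using add[of 0 0] by simp
  have diff: "g (s - t) = g s - g t" for s t
    using add[of "s - t" t] by simp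
  have nat: "g (of_nat n * t) = of_nat n * g t" for n t
    by (induction n) (simp_all add: zero add distrib_right)
  have "{t. g t = g 1 * t} = UNIV"
  proof (rule closed_subgroup_real_eq_UNIV)
    show "closed {t. g t = g 1 * t}"
      by (intro closed_Collect_eq continuous_intros cont)
    show "x - y \<in> {t. g t = g 1 * t}"
      if "x \<in> {t. g t = g 1 * t}" "y \<in> {t. g t = g 1 * t}" for x y
      using that by (simp add: diff algebra_simps)
    show "\<exists>t\<in>{t. g t = g 1 * t}. 0 < t \<and> t < e" if "e > 0" for e
    proof -
      obtain n where n: "n > 0" "inverse (of_nat n) < e"
        using ex_inverse_of_nat_less[OF \<open>e > 0\<close>] by blast
      have "g (inverse (of_nat n)) = g 1 * inverse (of_nat n)"
        using nat[of n "inverse (of_nat n)"] n(1) by (simp add: field_simps)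
      then show ?thesis using n by (intro bexI[of _ "inverse (of_nat n)"]) auto
    qed
  qed
  then show ?thesis by blast
qed

text \<open>\<open>A\<close> has no zero because A(t) A(-t) = 1, and is positive because A(t) is the
  square of A(t/2). So ln A is continuous and additive.\<close>

lemma continuous_multiplicative_real:
  fixes A :: "real \<Rightarrow> real"
  assumes cont: "continuous_on UNIV A" and mult: "\<And>s t. A (s + t) = A s * A t"
    and "A 0 = 1"
  obtains k where "\<And>t. A t = exp (k * t)"
proof -
  have nz: "A t \<noteq> 0" for t
    using mult[of t "- t"] \<open>A 0 = 1\<close> by auto
  have pos: "A t > 0" for t
    using mult[of "t / 2" "t / 2"] nz[of "t / 2"] by (simp add: zero_less_mult_iff) linarith
  have "ln (A t) = ln (A 1) * t" for t
  proof (rule continuous_additive_real)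
    show "continuous_on UNIV (\<lambda>t. ln (A t))"
      using nz by (intro continuous_intros cont) auto
    show "ln (A (s + t)) = ln (A s) + ln (A t)" for s t
      using pos[of s] pos[of t] by (simp add: mult ln_mult)
  qed
  then have "A t = exp (ln (A 1) * t)" for t
    using pos[of t] by (metis exp_ln)
  then show thesis by (rule that)
qed

lemma translation_self_affine_imp_affine_or_exp:
  fixes f :: "real \<Rightarrow> real"
  assumes cont: "continuous_on UNIV f"
    and unc: "uncountable {t. \<exists>A B. \<forall>x. f (x + t) = A * f x + B}"
  shows "\<exists>a b k. (\<forall>x. f x = a + b * x) \<or> (\<forall>x. f x = a + b * exp (k * x))"
proof (cases "\<exists>x\<^sub>0 x\<^sub>1. f x\<^sub>0 \<noteq> f x\<^sub>1")
  case False
  then have "\<forall>x. f x = f 0 + 0 * x" by auto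
  then show ?thesis by blast
next
  case True
  then obtain x\<^sub>0 x\<^sub>1 where ne: "f x\<^sub>0 \<noteq> f x\<^sub>1" by blast
  \<comment> \<open>Any relation f(x + t) = a f(x) + b, read at two points where \<open>f\<close>
    differs, forces these coefficients. The formulas make sense for every \<open>t\<close> and are
    continuous in \<open>t\<close>, which later gives closedness of \<open>P\<close>.\<close>
  define A where "A t = (f (x\<^sub>1 + t) - f (x\<^sub>0 + t)) / (f x\<^sub>1 - f x\<^sub>0)" for t
  define B where "B t = f (x\<^sub>0 + t) - A t * f x\<^sub>0" for t
  have contA: "continuous_on UNIV A" and contB: "continuous_on UNIV B"
    unfolding A_def B_def using ne
    by (intro continuous_intros continuous_on_compose2[OF cont]; simp)+
  have uniq: "a = A t \<and> b = B t" if "\<forall>x. f (x + t) = a * f x + b" for a b t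
  proof -
    have "f (x\<^sub>1 + t) = a * f x\<^sub>1 + b" "f (x\<^sub>0 + t) = a * f x\<^sub>0 + b"
      using that by blast+
    then have "a = A t"
      using ne unfolding A_def by (simp add: field_simps)
    then show ?thesis using that unfolding B_def by simp
  qed
  define P where "P = {t. \<forall>x. f (x + t) = A t * f x + B t}"
  have P_eq: "P = {t. \<exists>A B. \<forall>x. f (x + t) = A * f x + B}"
    unfolding P_def using uniq by blast
  have nz: "A t \<noteq> 0" if "t \<in> P" for t
  proof
    assume "A t = 0"
    then have "f (x + t) = B t" for x using that by (simp add: P_def)
    from this[of "x\<^sub>0 - t"] this[of "x\<^sub>1 - t"] ne show False by simp
  qed
  have diffP: "s - t \<in> P" if "s \<in> P" "t \<in> P" for s t
  proof -
    \<comment> \<open>Obtained by eliminating f(x - t) from the relations for \<open>s\<close> and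
      \<open>t\<close> at the point x - t.\<close>
    have "f (x + (s - t)) = A s / A t * f x + (B s - A s / A t * B t)" for x
    proof -
      have "f (x - t + t) = A t * f (x - t) + B t" "f (x - t + s) = A s * f (x - t) + B s"
        using that unfolding P_def by blast+
      then show ?thesis using nz[OF that(2)] by (simp add: field_simps)
    qed
    then show ?thesis unfolding P_eq by blast
  qed
  have "P = UNIV"
  proof (rule closed_subgroup_real_eq_UNIV)
    have "closed {t. f (x + t) = A t * f x + B t}" for x
      by (intro closed_Collect_eq continuous_intros contA contB continuous_on_compose2[OF cont]) auto
    then show "closed P"
      unfolding P_def by (intro closed_Collect_all) blast
    show "\<exists>t\<in>P. 0 < t \<and> t < e" if "e > 0" for e
      using uncountable_imp_close_points[OF unc[folded P_eq] that] diffP by blast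
  qed (rule diffP)
  then have eq: "f (x + t) = A t * f x + B t" for x t
    unfolding P_def by blast
  have comp: "A (s + t) = A s * A t \<and> B (s + t) = A s * B t + B s" for s t
  proof -
    have "\<forall>x. f (x + (s + t)) = A s * A t * f x + (A s * B t + B s)"
    proof
      fix x
      have "x + (s + t) = (x + t) + s" by simp
      then have "f (x + (s + t)) = A s * (A t * f x + B t) + B s"
        by (simp only: eq)
      then show "f (x + (s + t)) = A s * A t * f x + (A s * B t + B s)"
        by (simp add: distrib_left)
    qed
    then show ?thesis using uniq by metis
  qed
  have "A 0 = 1" using ne by (simp add: A_def)
  then obtain k where k: "A t = exp (k * t)" for t
    using continuous_multiplicative_real[OF contA] comp by blast
  have f: "f t = A t * f 0 + B t" for t
    using eq[of 0 t] by simp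
  show ?thesis
  proof (cases "k = 0")
    case True
    then have "B t = B 1 * t" for t
      using comp k by (intro continuous_additive_real contB) simp
    then have "f t = f 0 + B 1 * t" for t
      using f[of t] k True by (metis mult_zero_left exp_zero mult_1)
    then show ?thesis by blast
  next
    case False
    then have A1: "A 1 \<noteq> 1" using k by simp
    \<comment> \<open>\<open>d\<close> is the fixed point of y -> A(1) y + B(1). Comparing B(1 + t)
      with B(t + 1) shows that it is fixed by y -> A(t) y + B(t) for every \<open>t\<close>.\<close>
    define d where "d = B 1 / (1 - A 1)"
    have Bd: "B t = d * (1 - A t)" for t
    proof -
      have "A 1 * B t + B 1 = A t * B 1 + B t"
        using comp[of 1 t] comp[of t 1] by (simp add: add.commute)
      then show ?thesis using A1 unfolding d_def by (simp add: field_simps)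
    qed
    have "f t = d + (f 0 - d) * exp (k * t)" for t
      unfolding f[of t] Bd k by (simp add: algebra_simps)
    then show ?thesis by blast
  qed
qed

subsection \<open>The cone of chord directions\<close>

definition chord_slopes :: "(real \<Rightarrow> real) \<Rightarrow> real set" where
  "chord_slopes f = {(f y - f x) / (y - x) | x y. x \<noteq> y}"

definition slope_cone :: "real set \<Rightarrow> (real \<times> real) set" where
  "slope_cone I = {w. fst w \<noteq> 0 \<and> snd w / fst w \<in> I}"

text \<open>A chord slope is symmetric in its endpoints, so positive increments h suffice. The
  slopes are then a continuous image of a connected half plane.\<close>

lemma is_interval_chord_slopes:
  assumes "continuous_on UNIV f"
  shows "is_interval (chord_slopes f)"
proof -
  let ?q = "\<lambda>(x, h). (f (x + h) - f x) / h"
  have "chord_slopes f = ?q ` (UNIV \<times> {0<..})"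
  proof (intro equalityI subsetI)
    fix m assume "m \<in> chord_slopes f"
    then obtain x y where m: "m = (f y - f x) / (y - x)" and "x \<noteq> y"
      by (auto simp: chord_slopes_def)
    consider "x < y" | "y < x" using \<open>x \<noteq> y\<close> by linarith
    then show "m \<in> ?q ` (UNIV \<times> {0<..})"
    proof cases
      case 1
      then show ?thesis using m by (intro image_eqI[of _ _ "(x, y - x)"]) auto
    next
      case 2
      moreover have "m = (f x - f y) / (x - y)"
        using m minus_divide_divide[of "f x - f y" "x - y"] by simp
      ultimately show ?thesis by (intro image_eqI[of _ _ "(y, x - y)"]) auto
    qed
  next
    fix m assume "m \<in> ?q ` (UNIV \<times> {0<..})"
    then obtain x h where "m = (f (x + h) - f x) / h" "h > 0" by auto
    then show "m \<in> chord_slopes f"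
      unfolding chord_slopes_def by (intro CollectI exI[of _ x] exI[of _ "x + h"]) simp
  qed
  moreover have "connected (?q ` (UNIV \<times> {0<..}))"
  proof (rule connected_continuous_image)
    show "continuous_on (UNIV \<times> {0<..}) ?q"
      unfolding case_prod_unfold
      by (intro continuous_intros continuous_on_compose2[OF assms]) auto
    show "connected (UNIV \<times> {0::real<..} :: (real \<times> real) set)"
      by (intro connected_Times) auto
  qed
  ultimately show ?thesis by (simp add: is_interval_connected_1)
qed

text \<open>Describing the cone by differences of graph points, without quotients, makes its
  behaviour under affine maps visible.\<close>

lemma slope_cone_chord_slopes:
  "slope_cone (chord_slopes f) =
    {l *\<^sub>R (p - q) | l p q. l \<noteq> 0 \<and> p \<in> graph_of f \<and> q \<in> graph_of f \<and> p \<noteq> q}"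
proof (intro equalityI subsetI)
  fix w assume w: "w \<in> slope_cone (chord_slopes f)"
  then obtain x y where xy: "snd w / fst w = (f y - f x) / (y - x)" "x \<noteq> y" "fst w \<noteq> 0"
    by (auto simp: slope_cone_def chord_slopes_def)
  have "w = (fst w / (y - x)) *\<^sub>R ((y, f y) - (x, f x))"
    using xy by (auto simp: prod_eq_iff field_simps)
  moreover have "fst w / (y - x) \<noteq> 0" using xy by simp
  ultimately show "w \<in> {l *\<^sub>R (p - q) | l p q. l \<noteq> 0 \<and> p \<in> graph_of f \<and> q \<in> graph_of f \<and> p \<noteq> q}"
    using \<open>x \<noteq> y\<close> unfolding graph_of_def by blast
next
  fix w assume "w \<in> {l *\<^sub>R (p - q) | l p q. l \<noteq> 0 \<and> p \<in> graph_of f \<and> q \<in> graph_of f \<and> p \<noteq> q}"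
  then obtain l x y where w: "w = l *\<^sub>R ((y, f y) - (x, f x))" "l \<noteq> 0" "x \<noteq> y"
    by (auto simp: graph_of_def)
  then have "snd w / fst w = (f y - f x) / (y - x)" "fst w \<noteq> 0" by auto
  then show "w \<in> slope_cone (chord_slopes f)"
    using \<open>x \<noteq> y\<close> unfolding slope_cone_def chord_slopes_def by blast
qed

text \<open>The translation cancels in differences of graph points, and injectivity keeps distinct
  points distinct.\<close>

lemma linear_image_slope_cone:
  assumes "linear T" "inj T" and img: "(\<lambda>p. T p + v) ` graph_of f = graph_of f"
  shows "T ` slope_cone (chord_slopes f) = slope_cone (chord_slopes f)"
proof -
  have T: "T (l *\<^sub>R (p - q)) = l *\<^sub>R ((T p + v) - (T q + v))" for l p q
    using assms(1) by (simp add: linear_scale linear_diff)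
  have ne: "T p + v \<noteq> T q + v" if "p \<noteq> q" for p q
    using assms(2) that by (auto dest: injD)
  show ?thesis
  proof (intro equalityI subsetI)
    fix w assume "w \<in> T ` slope_cone (chord_slopes f)"
    then obtain l p q where "w = T (l *\<^sub>R (p - q))" "l \<noteq> 0" "p \<in> graph_of f" "q \<in> graph_of f" "p \<noteq> q"
      unfolding slope_cone_chord_slopes by blast
    moreover have "T p + v \<in> graph_of f" "T q + v \<in> graph_of f"
      using calculation img by blast+
    ultimately show "w \<in> slope_cone (chord_slopes f)"
      unfolding slope_cone_chord_slopes using T[of l p q] ne[of p q] by blast
  next
    fix w assume "w \<in> slope_cone (chord_slopes f)"
    then obtain l p' q' where w: "w = l *\<^sub>R (p' - q')" "l \<noteq> 0" "p' \<in> graph_of f" "q' \<in> graph_of f" "p' \<noteq> q'"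
      unfolding slope_cone_chord_slopes by blast
    then obtain p q where "p' = T p + v" "q' = T q + v" "p \<in> graph_of f" "q \<in> graph_of f"
      using img by (metis (no_types, lifting) imageE)
    then show "w \<in> T ` slope_cone (chord_slopes f)"
      unfolding slope_cone_chord_slopes using w T[of l p q]
      by (intro image_eqI[of _ _ "l *\<^sub>R (p - q)"]) (simp, blast)
  qed
qed

section \<open>Boundary lines of the cone and endpoints of the slope interval\<close>

lemma linear_image_frontier:
  fixes T :: "'a::euclidean_space \<Rightarrow> 'a"
  assumes "linear T" "inj T"
  shows "T ` frontier S = frontier (T ` S)"
  using assms by (simp add: frontier_def image_set_diff interior_injective_linear_image
      closure_injective_linear_image)

text \<open>Off the vertical axis the slope is continuous, so slopes interior to \<open>I\<close> or
  to its complement come from points interior to the cone or to its complement.\<close>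

lemma frontier_slope_cone_nonvertical:
  assumes w: "w \<in> frontier (slope_cone I)" "fst w \<noteq> 0"
  shows "snd w / fst w \<in> frontier I"
proof (rule ccontr)
  have op: "open {w :: real \<times> real. fst w \<noteq> 0 \<and> snd w / fst w \<in> U}" if "open U" for U
  proof -
    have "open ({w :: real \<times> real. fst w \<noteq> 0} \<inter> (\<lambda>w. snd w / fst w) -` U)"
      using that by (intro continuous_open_preimage continuous_intros open_Collect_neq) auto
    then show ?thesis by (simp add: Collect_conj_eq vimage_def)
  qed
  assume "snd w / fst w \<notin> frontier I"
  then consider "snd w / fst w \<in> interior I" | "snd w / fst w \<in> interior (- I)"
    by (auto simp: frontier_interiors)
  then show False
  proof cases
    case 1
    then have "w \<in> interior (slope_cone I)"
      using op[of "interior I"] w(2) interior_subset[of I]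
      by (intro interiorI[of "{w. fst w \<noteq> 0 \<and> snd w / fst w \<in> interior I}"])
        (auto simp: slope_cone_def)
    then show False using w(1) by (simp add: frontier_def)
  next
    case 2
    then have "w \<in> interior (- slope_cone I)"
      using op[of "interior (- I)"] w(2) interior_subset[of "- I"]
      by (intro interiorI[of "{w. fst w \<noteq> 0 \<and> snd w / fst w \<in> interior (- I)}"])
        (auto simp: slope_cone_def)
    then show False using w(1) by (simp add: frontier_interiors)
  qed
qed

lemma frontier_slope_coneI:
  assumes "s \<in> frontier I"
  shows "(1, s) \<in> frontier (slope_cone I)"
proof -
  have "(1, s) \<in> closure (slope_cone J)" if "s \<in> closure J" for J
  proof -
    have "Pair 1 ` closure J \<subseteq> closure (slope_cone J)"
      by (rule image_closure_subset)
        (auto intro!: continuous_intros closure_subset[THEN subsetD] simp: slope_cone_def)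
    then show ?thesis using that by blast
  qed
  \<comment> \<open>Only an inclusion is available: vertical vectors lie in the complement of the
    cone but in no cone of slopes.\<close>
  moreover have "closure (slope_cone (- I)) \<subseteq> closure (- slope_cone I)"
    by (intro closure_mono) (auto simp: slope_cone_def)
  ultimately show ?thesis using assms by (auto simp: frontier_closures)
qed

text \<open>For slopes s in \<open>I\<close> with |s| large, the vectors (1/s, 1) of the cone
  approach (0, 1), which is itself outside the cone.\<close>

lemma vertical_in_frontier_slope_cone:
  assumes "\<not> bounded I"
  shows "(0, 1) \<in> frontier (slope_cone I)"
proof -
  have "(0, 1) \<in> closure (slope_cone I)"
    unfolding closure_approachable
  proof (intro allI impI)
    fix e :: real assume "e > 0"
    obtain s where s: "s \<in> I" "\<bar>s\<bar> > 1 / e"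
      using assms by (force simp: bounded_iff not_le)
    then have "s \<noteq> 0" using \<open>e > 0\<close> by (auto simp: less_divide_eq divide_less_0_iff)
    have "dist (1 / s, 1) (0, 1 :: real) = 1 / \<bar>s\<bar>"
      by (simp add: dist_Pair_Pair dist_real_def)
    also have "\<dots> < e"
      using s(2) \<open>e > 0\<close> \<open>s \<noteq> 0\<close> by (simp add: field_simps)
    finally have "dist (1 / s, 1) (0, 1 :: real) < e" .
    moreover have "(1 / s, 1) \<in> slope_cone I"
      using s(1) \<open>s \<noteq> 0\<close> by (simp add: slope_cone_def)
    ultimately show "\<exists>y\<in>slope_cone I. dist y (0, 1) < e" by blast
  qed
  moreover have "(0, 1) \<notin> interior (slope_cone I)"
    using interior_subset[of "slope_cone I"] by (auto simp: slope_cone_def)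
  ultimately show ?thesis by (simp add: frontier_def)
qed

text \<open>A bound M on the slopes confines the cone to the closed region |y| <= M |x|, which meets
  the vertical axis only at the origin.\<close>

lemma frontier_slope_cone_bounded:
  assumes "bounded I" and w: "w \<in> frontier (slope_cone I)" "fst w = 0"
  shows "w = 0"
proof -
  obtain M where M: "\<And>s. s \<in> I \<Longrightarrow> \<bar>s\<bar> \<le> M"
    using assms(1) by (auto simp: bounded_iff)
  have "slope_cone I \<subseteq> {w. \<bar>snd w\<bar> \<le> M * \<bar>fst w\<bar>}"
  proof
    fix w assume "w \<in> slope_cone I"
    then show "w \<in> {w. \<bar>snd w\<bar> \<le> M * \<bar>fst w\<bar>}"
      using M[of "snd w / fst w"] by (auto simp: slope_cone_def field_simps)
  qed
  moreover have "closed {w :: real \<times> real. \<bar>snd w\<bar> \<le> M * \<bar>fst w\<bar>}"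
    by (intro closed_Collect_le continuous_intros)
  ultimately have "closure (slope_cone I) \<subseteq> {w. \<bar>snd w\<bar> \<le> M * \<bar>fst w\<bar>}"
    by (rule closure_minimal)
  then have "\<bar>snd w\<bar> \<le> M * \<bar>fst w\<bar>"
    using w(1) unfolding frontier_def by blast
  then show ?thesis using w(2) by (simp add: prod_eq_iff)
qed

text \<open>A frontier point cannot lie strictly between two points of \<open>I\<close>, so it
  bounds \<open>I\<close> on one side. For unbounded \<open>I\<close>, \<open>Inf I\<close> or
  \<open>Sup I\<close> may be an unspecified value; the inclusion still shows that the frontier is
  finite.\<close>

lemma frontier_interval_subset:
  fixes I :: "real set"
  assumes "is_interval I"
  shows "frontier I \<subseteq> {Inf I, Sup I}"
proof
  fix x assume x: "x \<in> frontier I"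
  then have cl: "x \<in> closure I" by (simp add: frontier_def)
  then have "I \<noteq> {}" by auto
  have "\<not> (\<exists>y\<in>I. \<exists>z\<in>I. y < x \<and> x < z)"
  proof
    assume "\<exists>y\<in>I. \<exists>z\<in>I. y < x \<and> x < z"
    then obtain y z where "y \<in> I" "z \<in> I" "y < x" "x < z" by blast
    moreover have "{y<..<z} \<subseteq> I"
      using mem_is_interval_1_I[OF assms \<open>y \<in> I\<close> \<open>z \<in> I\<close>] by auto
    ultimately have "x \<in> interior I"
      by (intro interiorI[of "{y<..<z}"]) auto
    then show False using x by (simp add: frontier_def)
  qed
  then consider "\<And>y. y \<in> I \<Longrightarrow> x \<le> y" | "\<And>y. y \<in> I \<Longrightarrow> y \<le> x"
    by (meson not_le)
  then show "x \<in> {Inf I, Sup I}"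
  proof cases
    case 1
    have "bdd_below I" using 1 by (rule bdd_belowI)
    then have "I \<subseteq> {Inf I..}" by (auto intro: cInf_lower)
    then have "Inf I \<le> x" using closure_minimal[of I "{Inf I..}"] cl by auto
    moreover have "x \<le> Inf I" using 1 \<open>I \<noteq> {}\<close> by (rule cInf_greatest[rotated])
    ultimately show ?thesis by simp
  next
    case 2
    have "bdd_above I" using 2 by (rule bdd_aboveI)
    then have "I \<subseteq> {..Sup I}" by (auto intro: cSup_upper)
    then have "x \<le> Sup I" using closure_minimal[of I "{..Sup I}"] cl by auto
    moreover have "Sup I \<le> x" using 2 \<open>I \<noteq> {}\<close> by (rule cSup_least[rotated])
    ultimately show ?thesis by simp
  qed
qed

lemma Inf_Sup_in_frontier:
  fixes I :: "real set"
  assumes "bounded I" "I \<noteq> {}"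
  shows "Inf I \<in> frontier I" "Sup I \<in> frontier I"
proof -
  have b: "bdd_below I" "bdd_above I"
    using assms(1) by (auto intro: bounded_imp_bdd_below bounded_imp_bdd_above)
  have "Inf I \<notin> interior I"
  proof
    assume "Inf I \<in> interior I"
    then obtain e where "e > 0" "cball (Inf I) e \<subseteq> I" by (auto simp: mem_interior_cball)
    then have "Inf I - e \<in> I" by (auto simp: dist_real_def)
    then show False using cInf_lower[OF _ b(1)] \<open>e > 0\<close> by fastforce
  qed
  moreover have "Sup I \<notin> interior I"
  proof
    assume "Sup I \<in> interior I"
    then obtain e where "e > 0" "cball (Sup I) e \<subseteq> I" by (auto simp: mem_interior_cball)
    then have "Sup I + e \<in> I" by (auto simp: dist_real_def)
    then show False using cSup_upper[OF _ b(2)] \<open>e > 0\<close> by fastforce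
  qed
  ultimately show "Inf I \<in> frontier I" "Sup I \<in> frontier I"
    using closure_contains_Inf[OF assms(2) b(1)] closure_contains_Sup[OF assms(2) b(2)]
    by (auto simp: frontier_def)
qed

subsection \<open>The linear parts of the isometries\<close>

lemma plane_isometry_decompose:
  assumes "plane_isometry \<phi>"
  obtains L v where "orthogonal_transformation L" "\<phi> = (\<lambda>p. L p + v)"
proof (rule that[of "\<lambda>p. \<phi> p - \<phi> 0" "\<phi> 0"])
  show "orthogonal_transformation (\<lambda>p. \<phi> p - \<phi> 0)"
    using assms unfolding orthogonal_transformation_isometry plane_isometry_def
    by (simp add: dist_norm)
qed simp

lemma orthogonal_transformation_plane_first_axis:
  fixes L :: "real \<times> real \<Rightarrow> real \<times> real"
  assumes L: "orthogonal_transformation L" and "L (0, 1) = (a, b)"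
  shows "L (1, 0) = (b, - a) \<or> L (1, 0) = (- b, a)"
proof -
  obtain u v where uv: "L (1, 0) = (u, v)" by fastforce
  have inner: "L p \<bullet> L q = p \<bullet> q" for p q
    using L unfolding orthogonal_transformation_def by blast
  have 1: "a * a + b * b = 1" "u * u + v * v = 1" "u * a + v * b = 0"
    using inner[of "(0, 1)" "(0, 1)"] inner[of "(1, 0)" "(1, 0)"] inner[of "(1, 0)" "(0, 1)"]
    by (simp_all add: assms uv)
  \<comment> \<open>\<open>d\<close> is the determinant of \<open>L\<close>; Lagrange's identity
    gives d^2 = 1.\<close>
  define d where "d = u * b - v * a"
  have "d * d = (a * a + b * b) * (u * u + v * v) - (u * a + v * b) * (u * a + v * b)"
    unfolding d_def by (simp add: algebra_simps)
  then have "d * d = 1" by (simp add: 1)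
  then have "d = 1 \<or> d = -1" by (simp add: square_eq_1_iff)
  moreover have "u = b * d"
  proof -
    have "b * d = u * (a * a + b * b) - a * (u * a + v * b)"
      unfolding d_def by (simp add: algebra_simps)
    then show ?thesis by (simp add: 1)
  qed
  moreover have "v = - a * d"
  proof -
    have "- a * d = v * (a * a + b * b) - b * (u * a + v * b)"
      unfolding d_def by (simp add: algebra_simps)
    then show ?thesis by (simp add: 1)
  qed
  ultimately show ?thesis using uv by auto
qed

lemma unit_vector_slope:
  fixes a b :: real
  assumes "a * a + b * b = 1" "a \<noteq> 0"
  shows "(a, b) \<in> {(1 / sqrt (1 + (b/a)\<^sup>2), (b/a) / sqrt (1 + (b/a)\<^sup>2)),
                  (- 1 / sqrt (1 + (b/a)\<^sup>2), - (b/a) / sqrt (1 + (b/a)\<^sup>2))}"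
proof -
  have "1 + (b/a)\<^sup>2 = (1 / a)\<^sup>2"
    using assms by (simp add: power2_eq_square field_simps)
  then have "sqrt (1 + (b/a)\<^sup>2) = 1 / \<bar>a\<bar>" by simp
  then show ?thesis using assms(2) by (cases "a > 0") auto
qed

text \<open>Each slope in \<open>F\<close> belongs to exactly two opposite unit vectors, and the
  vertical line adds two more.\<close>

lemma countable_unit_vectors_slope:
  fixes F :: "real set"
  assumes "countable F"
  shows "countable {(a, b). a * a + b * b = 1 \<and> (a = 0 \<or> b / a \<in> F)}"
proof (rule countable_subset)
  let ?p = "\<lambda>m::real. (1 / sqrt (1 + m\<^sup>2), m / sqrt (1 + m\<^sup>2))"
  let ?n = "\<lambda>m::real. (- 1 / sqrt (1 + m\<^sup>2), - m / sqrt (1 + m\<^sup>2))"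
  show "countable (?p ` F \<union> ?n ` F \<union> {(0, 1), (0, -1)})"
    using assms by simp
  show "{(a, b). a * a + b * b = 1 \<and> (a = 0 \<or> b / a \<in> F)} \<subseteq> ?p ` F \<union> ?n ` F \<union> {(0, 1), (0, -1)}"
  proof
    fix w assume "w \<in> {(a, b). a * a + b * b = 1 \<and> (a = 0 \<or> b / a \<in> F)}"
    then obtain a b where w: "w = (a, b)" "a * a + b * b = 1" "a = 0 \<or> b / a \<in> F" by blast
    show "w \<in> ?p ` F \<union> ?n ` F \<union> {(0, 1), (0, -1)}"
    proof (cases "a = 0")
      case True
      then show ?thesis using w by (auto simp: square_eq_1_iff)
    next
      case False
      then show ?thesis using w unit_vector_slope[OF w(2)] by blast
    qed
  qed
qed

lemma uncountable_fibre:
  assumes "uncountable A" "countable (h ` A)"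
  obtains y where "uncountable {x \<in> A. h x = y}"
proof (rule ccontr)
  assume "\<not> thesis"
  then have "countable (\<Union>y\<in>h ` A. {x \<in> A. h x = y})"
    using assms(2) that by blast
  moreover have "(\<Union>y\<in>h ` A. {x \<in> A. h x = y}) = A" by blast
  ultimately show False using assms(1) by simp
qed

text \<open>With L(u) = v - w one has L(p) + v = L(p + u) + w, so injectivity of \<open>L\<close>
  places the graph of \<open>g\<close> shifted by \<open>u\<close> inside that of
  \<open>h\<close>.\<close>

lemma same_linear_part_imp_translate:
  fixes L :: "real \<times> real \<Rightarrow> real \<times> real"
  assumes "linear L" "inj L"
    and "(\<lambda>p. L p + v) ` graph_of g = G" "(\<lambda>p. L p + w) ` graph_of h = G"
  shows "\<exists>a b. \<forall>x. h (x + a) = g x + b"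
proof -
  obtain u where u: "L u = v - w"
    using linear_injective_imp_surjective[OF assms(1,2)] by (metis surjD)
  have "h (x + fst u) = g x + snd u" for x
  proof -
    have "(x, g x) \<in> graph_of g" by (simp add: graph_of_def)
    then have "L (x, g x) + v \<in> (\<lambda>p. L p + w) ` graph_of h" using assms(3,4) by blast
    then obtain y where "L (x, g x) + v = L (y, h y) + w" by (auto simp: graph_of_def)
    then have "L ((x, g x) + u) = L (y, h y)"
      unfolding linear_add[OF assms(1)] u by (simp add: algebra_simps)
    with assms(2) have "(x, g x) + u = (y, h y)" by (rule injD)
    then show ?thesis by (metis fst_add snd_add fst_conv snd_conv)
  qed
  then show ?thesis by blast
qed

section \<open>The angle between two boundary lines\<close>

text \<open>The difference of the two sides factors completely, and c > 0 excludes the root -1. If s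
  t = 0 only c = 1 survives, the other two listed values being division by zero.\<close>

lemma angle_identity_imp_scale:
  fixes s t c :: real
  assumes "s \<noteq> t" "c > 0"
    and angle: "(1 + s * t)\<^sup>2 * ((1 + (c * s)\<^sup>2) * (1 + (c * t)\<^sup>2)) =
      (1 + c\<^sup>2 * s * t)\<^sup>2 * ((1 + s\<^sup>2) * (1 + t\<^sup>2))"
  shows "c \<in> {1, 1 / (s * t), - 1 / (s * t)}"
proof -
  have "(1 - c) * (1 + c) * (1 - c * (s * t)) * (1 + c * (s * t)) * (s - t)\<^sup>2 =
      (1 + c\<^sup>2 * s * t)\<^sup>2 * ((1 + s\<^sup>2) * (1 + t\<^sup>2)) -
      (1 + s * t)\<^sup>2 * ((1 + (c * s)\<^sup>2) * (1 + (c * t)\<^sup>2))"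
    by algebra
  then have "(1 - c) * (1 + c) * (1 - c * (s * t)) * (1 + c * (s * t)) = 0"
    using angle assms(1) by simp
  then consider "c = 1" | "c * (s * t) = 1" | "c * (s * t) = - 1"
    using assms(2) by auto
  then show ?thesis
  proof cases
    case 2
    then have "s * t \<noteq> 0" by auto
    with 2 show ?thesis by (simp add: field_simps)
  next
    case 3
    then have "s * t \<noteq> 0" by auto
    with 3 show ?thesis by (simp add: field_simps)
  qed simp
qed

text \<open>This equates the squared cosines of the angles between the lines of slopes
  \<open>x\<close>, \<open>y\<close> and between those of slopes \<open>x'\<close>,
  \<open>y'\<close>, with denominators cleared. Squaring removes the signs of \<open>l\<close> and
  \<open>m\<close>.\<close>

lemma orthogonal_lines_imp_angle:
  fixes L :: "real \<times> real \<Rightarrow> real \<times> real"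
  assumes "orthogonal_transformation L"
    and "L (1, x) = (l, l * x')" "L (1, y) = (m, m * y')"
  shows "(1 + x' * y')\<^sup>2 * ((1 + x\<^sup>2) * (1 + y\<^sup>2)) = (1 + x * y)\<^sup>2 * ((1 + x'\<^sup>2) * (1 + y'\<^sup>2))"
proof -
  have inner: "L p \<bullet> L q = p \<bullet> q" for p q
    using assms(1) unfolding orthogonal_transformation_def by blast
  have "1 + x\<^sup>2 = l\<^sup>2 * (1 + x'\<^sup>2)" "1 + y\<^sup>2 = m\<^sup>2 * (1 + y'\<^sup>2)" "1 + x * y = l * m * (1 + x' * y')"
    using inner[of "(1, x)" "(1, x)"] inner[of "(1, y)" "(1, y)"] inner[of "(1, x)" "(1, y)"]
    unfolding assms(2,3) by (simp_all add: power2_eq_square algebra_simps)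
  then show ?thesis by (simp add: power2_eq_square)
qed

lemma bounded_slopes_imp_scale:
  fixes L :: "real \<times> real \<Rightarrow> real \<times> real"
  assumes "orthogonal_transformation L" "c > 0" and I: "is_interval I" "bounded I" "I \<noteq> {}" "Inf I \<noteq> Sup I"
    and T: "\<And>w. w \<in> frontier (slope_cone I) \<Longrightarrow> L (fst w, c * snd w) \<in> frontier (slope_cone I)"
  shows "c \<in> {1, 1 / (Inf I * Sup I), - 1 / (Inf I * Sup I)}"
proof -
  define s t where "s = Inf I" and "t = Sup I"
  have "s \<noteq> t" using I(4) by (simp add: s_def t_def)
  have lin: "linear L" and inj: "inj L"
    using assms(1) by (auto intro: orthogonal_transformation_linear orthogonal_transformation_inj)
  have img: "\<exists>l x'. L (1, c * x) = (l, l * x') \<and> x' \<in> {s, t}" if "x \<in> {s, t}" for x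
  proof -
    let ?w = "L (1, c * x)"
    have "x \<in> frontier I"
      using that Inf_Sup_in_frontier[OF I(2,3)] by (auto simp: s_def t_def)
    then have w: "?w \<in> frontier (slope_cone I)"
      using T[of "(1, x)"] by (simp add: frontier_slope_coneI)
    have "?w \<noteq> 0"
      using inj linear_0[OF lin] by (metis injD prod.inject zero_neq_one zero_prod_def)
    then have "fst ?w \<noteq> 0"
      using frontier_slope_cone_bounded[OF I(2) w] by blast
    moreover have "snd ?w / fst ?w \<in> {s, t}"
      using frontier_slope_cone_nonvertical[OF w \<open>fst ?w \<noteq> 0\<close>] frontier_interval_subset[OF I(1)]
      by (auto simp: s_def t_def)
    ultimately show ?thesis
      by (intro exI[of _ "fst ?w"] exI[of _ "snd ?w / fst ?w"]) (simp add: prod_eq_iff)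
  qed
  obtain l s' where ls: "L (1, c * s) = (l, l * s')" "s' \<in> {s, t}" using img[of s] by blast
  obtain m t' where mt: "L (1, c * t) = (m, m * t')" "t' \<in> {s, t}" using img[of t] by blast
  have "s' \<noteq> t'"
  proof
    assume "s' = t'"
    \<comment> \<open>The multipliers are crossed so that both images become l m (1, s'): two
      distinct lines would be sent to one.\<close>
    then have "L (m *\<^sub>R (1, c * s)) = L (l *\<^sub>R (1, c * t))"
      by (simp add: linear_scale[OF lin] ls mt del: scaleR_Pair) (simp add: mult.left_commute)
    with inj have "m *\<^sub>R (1 :: real, c * s) = l *\<^sub>R (1, c * t)" by (rule injD)
    then have "m = l" "l * (c * s) = l * (c * t)" by auto
    then have "l = 0" using \<open>s \<noteq> t\<close> \<open>c > 0\<close> by simp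
    then have "L (1, c * s) = L 0" using ls linear_0[OF lin] by (simp add: zero_prod_def)
    with inj have "(1 :: real, c * s) = 0" by (rule injD)
    then show False by (simp add: zero_prod_def)
  qed
  \<comment> \<open>The two boundary lines are either kept or exchanged; the angle identity is
    symmetric and covers both cases.\<close>
  then have "s' = s \<and> t' = t \<or> s' = t \<and> t' = s" using ls(2) mt(2) by auto
  then have "(1 + s * t)\<^sup>2 * ((1 + (c * s)\<^sup>2) * (1 + (c * t)\<^sup>2)) =
      (1 + c\<^sup>2 * s * t)\<^sup>2 * ((1 + s\<^sup>2) * (1 + t\<^sup>2))"
    using orthogonal_lines_imp_angle[OF assms(1) ls(1) mt(1)]
    by (auto simp: power2_eq_square mult_ac)
  then show ?thesis
    using angle_identity_imp_scale[OF \<open>s \<noteq> t\<close> \<open>c > 0\<close>] by (simp add: s_def t_def)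
qed

lemma constant_chord_slope_imp_affine:
  assumes "chord_slopes f \<subseteq> {m}"
  shows "f x = f 0 + m * x"
proof (cases "x = 0")
  case False
  then have "(f x - f 0) / (x - 0) \<in> chord_slopes f" unfolding chord_slopes_def by blast
  then have "(f x - f 0) / x = m" using assms by auto
  then show ?thesis using False by (simp add: field_simps)
qed simp

section \<open>Case distinction on the interval of chord slopes\<close>

theorem mainTheorem2:
  fixes f :: "real \<Rightarrow> real" and C :: "real set"
  assumes "continuous_on UNIV f"
    and "C \<subseteq> {0<..}"
    and "uncountable C"
    and "vertically_rigid_for f C"
  shows "\<exists>a b k :: real. (\<forall>x. f x = a + b * x) \<or> (\<forall>x. f x = a + b * exp (k * x))"
proof -
  define I where "I = chord_slopes f"
  have I: "is_interval I" unfolding I_def by (rule is_interval_chord_slopes[OF assms(1)])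
  have ne: "I \<noteq> {}"
    unfolding I_def chord_slopes_def using zero_neq_one by blast
  have "\<exists>L v. orthogonal_transformation L \<and> (\<lambda>p. L p + v) ` graph_of (\<lambda>x. c * f x) = graph_of f"
    if "c \<in> C" for c
    using assms(4) that plane_isometry_decompose unfolding vertically_rigid_for_def by metis
  then obtain L v where orth: "\<And>c. c \<in> C \<Longrightarrow> orthogonal_transformation (L c)"
    and img: "\<And>c. c \<in> C \<Longrightarrow> (\<lambda>p. L c p + v c) ` graph_of (\<lambda>x. c * f x) = graph_of f"
    by metis
  \<comment> \<open>Stretching the graph of \<open>f\<close> vertically by \<open>c\<close> and then
    applying the isometry returns the graph of \<open>f\<close>, so the linear part of this
    composition preserves the cone and its frontier.\<close>
  have T: "L c (fst w, c * snd w) \<in> frontier (slope_cone I)"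
    if "c \<in> C" "w \<in> frontier (slope_cone I)" for c w
  proof -
    let ?T = "\<lambda>w. L c (fst w, c * snd w)"
    have "c > 0" using assms(2) that by auto
    have "linear (\<lambda>w :: real \<times> real. (fst w, c * snd w))"
      by (rule linearI) (auto simp: algebra_simps)
    then have lin: "linear ?T"
      using orthogonal_transformation_linear[OF orth[OF that(1)]]
      by (auto dest: linear_compose simp: o_def)
    have inj: "inj ?T"
    proof (rule injI)
      fix x y assume "?T x = ?T y"
      with orthogonal_transformation_inj[OF orth[OF that(1)]]
      have "(fst x, c * snd x) = (fst y, c * snd y)" by (rule injD)
      then show "x = y" using \<open>c > 0\<close> by (simp add: prod_eq_iff)
    qed
    have "graph_of (\<lambda>x. c * f x) = (\<lambda>w. (fst w, c * snd w)) ` graph_of f"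
      by (auto simp: graph_of_def image_iff)
    then have "(\<lambda>p. ?T p + v c) ` graph_of f = graph_of f"
      using img[OF that(1)] by (simp add: image_image)
    then have "?T ` slope_cone I = slope_cone I"
      unfolding I_def by (rule linear_image_slope_cone[OF lin inj])
    then have "?T ` frontier (slope_cone I) = frontier (slope_cone I)"
      using linear_image_frontier[OF lin inj] by simp
    then show ?thesis using that(2) by blast
  qed
  consider "bounded I" "Inf I = Sup I" | "bounded I" "Inf I \<noteq> Sup I" | "\<not> bounded I" by blast
  then show ?thesis
  proof cases
    case 1
    have "x = Inf I" if "x \<in> I" for x
      using cInf_lower[OF that bounded_imp_bdd_below[OF 1(1)]]
        cSup_upper[OF that bounded_imp_bdd_above[OF 1(1)]] 1(2) by simp
    then have "I \<subseteq> {Inf I}" by blast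
    then have "\<forall>x. f x = f 0 + Inf I * x"
      using constant_chord_slope_imp_affine unfolding I_def by blast
    then show ?thesis by blast
  next
    case 2
    have "C \<subseteq> {1, 1 / (Inf I * Sup I), - 1 / (Inf I * Sup I)}"
      using bounded_slopes_imp_scale[OF orth _ I 2(1) ne 2(2) T] assms(2) by blast
    then have "countable C" by (rule countable_subset) simp
    then show ?thesis using assms(3) by blast
  next
    case 3
    define U where "U = {(a, b). a * a + b * b = 1 \<and> (a = 0 \<or> b / a \<in> frontier I)}"
    have "countable (frontier I)"
      using frontier_interval_subset[OF I] by (rule countable_subset) simp
    then have "countable U" unfolding U_def by (rule countable_unit_vectors_slope)
    have vert: "L c (0, 1) \<in> U" if c: "c \<in> C" for c
    proof -
      obtain a b where ab: "L c (0, 1) = (a, b)" by fastforce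
      have "c > 0" using assms(2) c by auto
      have "(0, c) = c *\<^sub>R (0, 1 :: real)" by simp
      then have "L c (0, c) = (c * a, c * b)"
        using orthogonal_transformation_scaleR[OF orth[OF c], of c "(0, 1)"] ab by simp
      then have "(c * a, c * b) \<in> frontier (slope_cone I)"
        using T[OF c vertical_in_frontier_slope_cone[OF 3]] by simp
      then have "a = 0 \<or> b / a \<in> frontier I"
        using frontier_slope_cone_nonvertical[of "(c * a, c * b)" I] \<open>c > 0\<close> by auto
      moreover have "a * a + b * b = 1"
        using orth[OF c] ab unfolding orthogonal_transformation_def
        by (metis inner_Pair inner_real_def mult_1 mult_zero_left add_0)
      ultimately show ?thesis by (simp add: U_def ab)
    qed
    \<comment> \<open>The images of the two basis vectors determine the linear map
      \<open>L c\<close>. Once the first lies in \<open>U\<close>, orthogonality leaves two choices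
      for the second, so only countably many linear parts occur.\<close>
    let ?h = "\<lambda>c. (L c (0, 1), L c (1, 0))"
    let ?V = "(\<lambda>(a, b). (b, - a)) ` U \<union> (\<lambda>(a, b). (- b, a)) ` U"
    have "?h ` C \<subseteq> U \<times> ?V"
    proof
      fix y assume "y \<in> ?h ` C"
      then obtain c where c: "c \<in> C" "y = ?h c" by blast
      obtain a b where ab: "L c (0, 1) = (a, b)" by fastforce
      then have "(a, b) \<in> U" using vert[OF c(1)] by simp
      moreover have "L c (1, 0) = (b, - a) \<or> L c (1, 0) = (- b, a)"
        by (rule orthogonal_transformation_plane_first_axis[OF orth[OF c(1)] ab])
      ultimately have "L c (1, 0) \<in> ?V" by force
      then show "y \<in> U \<times> ?V" using vert c by simp
    qed
    then have "countable (?h ` C)"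
      by (rule countable_subset) (intro countable_SIGMA countable_Un countable_image \<open>countable U\<close>)
    then obtain y where y: "uncountable {c \<in> C. ?h c = y}"
      using uncountable_fibre[OF assms(3)] by blast
    define C' where "C' = {c \<in> C. ?h c = y}"
    have unc: "uncountable C'" using y by (simp add: C'_def)
    \<comment> \<open>A fixed reference factor: for every c in \<open>C'\<close> the graph of c f is
      a translate of the graph of d f.\<close>
    then obtain d where d: "d \<in> C'" by fastforce
    have "d > 0" using d assms(2) by (auto simp: C'_def)
    have same: "L c = L d" if "c \<in> C'" for c
    proof
      fix p
      have e: "L c (0, 1) = L d (0, 1)" "L c (1, 0) = L d (1, 0)"
        using that d by (auto simp: C'_def)
      have M: "M p = fst p *\<^sub>R M (1, 0) + snd p *\<^sub>R M (0, 1)" if "linear M" for M :: "real \<times> real \<Rightarrow> real \<times> real"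
      proof -
        have "M p = M (fst p *\<^sub>R (1, 0) + snd p *\<^sub>R (0, 1))" by simp
        then show ?thesis unfolding linear_add[OF that] linear_scale[OF that] .
      qed
      have lin: "linear (L c)" "linear (L d)"
        using that d orth by (auto simp: C'_def intro: orthogonal_transformation_linear)
      show "L c p = L d p" unfolding M[OF lin(1)] M[OF lin(2)] e ..
    qed
    have "\<exists>a b. \<forall>x. d * f (x + a) = c * f x + b" if "c \<in> C'" for c
    proof -
      have cd: "c \<in> C" "d \<in> C" using that d by (auto simp: C'_def)
      show ?thesis
        by (rule same_linear_part_imp_translate[OF orthogonal_transformation_linear[OF orth[OF cd(2)]]
              orthogonal_transformation_inj[OF orth[OF cd(2)]] img[OF cd(1), unfolded same[OF that]] img[OF cd(2)]])
    qed
    then obtain a b where ab: "\<And>c x. c \<in> C' \<Longrightarrow> d * f (x + a c) = c * f x + b c" by metis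
    show ?thesis
    proof (cases "\<exists>x\<^sub>0 x\<^sub>1. f x\<^sub>0 \<noteq> f x\<^sub>1")
      case False
      then have "\<forall>x. f x = f 0 + 0 * x" by auto
      then show ?thesis by blast
    next
      case True
      then obtain x\<^sub>0 x\<^sub>1 where ne: "f x\<^sub>0 \<noteq> f x\<^sub>1" by blast
      \<comment> \<open>If two factors shared a horizontal shift, subtracting their relations at
        \<open>x\<^sub>0\<close> and \<open>x\<^sub>1\<close> would make them equal. Hence
        uncountably many factors give uncountably many shifts.\<close>
      have "inj_on a C'"
      proof (rule inj_onI)
        fix c c' assume c: "c \<in> C'" "c' \<in> C'" "a c = a c'"
        have "c * f x + b c = c' * f x + b c'" for x
          using ab[OF c(1), of x] ab[OF c(2), of x] c(3) by simp
        from this[of x\<^sub>0] this[of x\<^sub>1] have "(c - c') * (f x\<^sub>0 - f x\<^sub>1) = 0"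
          by (simp add: algebra_simps)
        then show "c = c'" using ne by simp
      qed
      then have "uncountable (a ` C')" using unc countable_image_inj_on by blast
      moreover have "a ` C' \<subseteq> {t. \<exists>A B. \<forall>x. f (x + t) = A * f x + B}"
      proof clarify
        fix c assume "c \<in> C'"
        then have "\<forall>x. f (x + a c) = c / d * f x + b c / d"
          using ab \<open>d > 0\<close> by (simp add: field_simps)
        then show "\<exists>A B. \<forall>x. f (x + a c) = A * f x + B" by blast
      qed
      ultimately have "uncountable {t. \<exists>A B. \<forall>x. f (x + t) = A * f x + B}"
        using countable_subset by blast
      then show ?thesis by (rule translation_self_affine_imp_affine_or_exp[OF assms(1)])
    qed
  qed
qed

end
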